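(* Let $E\subseteq \mathbb R^2$ be a compact set, and let $\gamma:\mathbb R\to\mathbb R$ be a $C^1$ function whose derivative $\gamma'$ is injective. For $\alpha\in\mathbb R$ let $\Phi_\alpha:\mathbb R^2\to\mathbb R$, $\Phi_\alpha(\mathbf a)=a_2+\gamma(\alpha-a_1)$ for $\mathbf a=(a_1,a_2)$, be the curve projection at $\alpha$ associated with the curve $\Gamma=\{(t,\gamma(t)):t\in\mathbb R\}$. If there exist $\alpha,\alpha'\in\mathbb R$ such that $\alpha\ne\alpha'$ and $\mathcal{L}^1(\Phi_\alpha(E))=\mathcal{L}^1(\Phi_{\alpha'}(E))=0$, then $E$ is purely $1$-unrectifiable.
   Context: $\mathcal L^1$ is Lebesgue measure on $\mathbb R$ and $\mathcal H^1$ is $1$-dimensional Hausdorff measure. A set $\zeta\subseteq\mathbb R^2$ is a Lipschitz graph if there exist a Lipschitz function $F:\mathbb R\to\mathbb R$ and an orthonormal pair $\omega_1,\omega_2\in S^1$ such that $\zeta=\{x\omega_1+F(x)\omega_2:x\in\mathbb R\}$. A set $E\subseteq\mathbb R^2$ is purely $1$-unrectifiable if $\mathcal H^1(E\cap\zeta)=0$ for every Lipschitz graph $\zeta\subseteq\mathbb R^2$. *)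

theory Defs
  imports "HOL-Analysis.Analysis"
begin

(* The size-delta approximation to one-dimensional Hausdorff measure, by countable covers
   (finite covers are padded with {}).  Boundedness is required explicitly because
   diameter is unspecified on unbounded sets; diameter {} = 0. *)
definition hausdorff1_approx :: "real \<Rightarrow> 'a::metric_space set \<Rightarrow> ennreal" where
  "hausdorff1_approx \<delta> A =
     (INF U \<in> {U :: nat \<Rightarrow> 'a set. A \<subseteq> (\<Union>i. U i) \<and> (\<forall>i. bounded (U i) \<and> diameter (U i) \<le> \<delta>)}.
        \<Sum>i. ennreal (diameter (U i)))"

(* As an outer measure, defined on all subsets.  In dimension one the normalising constant
   is 1 under both usual conventions. *)
definition hausdorff1 :: "'a::metric_space set \<Rightarrow> ennreal" where
  "hausdorff1 A = (SUP \<delta> \<in> {0<..}. hausdorff1_approx \<delta> A)"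

definition lipschitz_graph :: "(real ^ 2) set \<Rightarrow> bool" where
  "lipschitz_graph \<zeta> \<longleftrightarrow>
     (\<exists>(F :: real \<Rightarrow> real) L \<omega>1 \<omega>2.
        L-lipschitz_on UNIV F \<and>
        norm \<omega>1 = 1 \<and> norm \<omega>2 = 1 \<and> \<omega>1 \<bullet> \<omega>2 = 0 \<and>
        \<zeta> = {x *\<^sub>R \<omega>1 + F x *\<^sub>R \<omega>2 | x. x \<in> UNIV})"

definition purely_1_unrectifiable :: "(real ^ 2) set \<Rightarrow> bool" where
  "purely_1_unrectifiable E \<longleftrightarrow> (\<forall>\<zeta>. lipschitz_graph \<zeta> \<longrightarrow> hausdorff1 (E \<inter> \<zeta>) = 0)"

definition curve_projection :: "(real \<Rightarrow> real) \<Rightarrow> real \<Rightarrow> real ^ 2 \<Rightarrow> real" where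
  "curve_projection \<gamma> \<alpha> a = a $ 2 + \<gamma> (\<alpha> - a $ 1)"

end

theory Submission
  imports Defs
begin

text \<open>
  Parametrise a Lipschitz graph by \<open>p x = x \<omega>1 + F x \<omega>2\<close>, put \<open>S = p -` E\<close>, and let \<open>f\<close> and \<open>g\<close> be the
  two curve projections composed with \<open>p\<close>. Where \<open>\<gamma>'\<close> takes different values at \<open>\<alpha> - p\<^sub>1\<close> and
  \<open>\<alpha>' - p\<^sub>1\<close>, the pair \<open>(f, g)\<close> is locally bi-Lipschitz. No differentiability of \<open>F\<close> is needed:
  since \<open>f(S)\<close> is null, the intermediate value theorem shows that the increment of \<open>f\<close> over an
  interval \<open>I\<close> is at most a constant times the measure of \<open>I - S\<close>, and likewise for \<open>g\<close>. By
  bi-Lipschitzness \<open>I - S\<close> then fills a fixed proportion of every small interval \<open>I\<close>, which forces \<open>S\<close>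
  to be null; hence so is \<open>p(S)\<close>, the intersection of \<open>E\<close> with the graph.
\<close>

section \<open>Interval covers of sets of reals\<close>

text \<open>A countable family of intervals with disjoint interiors approximates \<open>S\<close>
  from outside; disjointness turns its total length into the measure of its union. Indexing by
  naturals and summing in \<open>ennreal\<close> suits both countable subadditivity and the covers
  in \<open>hausdorff1_approx\<close>.\<close>

lemma lebesgue_interval_cover:
  fixes S :: "real set"
  assumes "S \<in> lmeasurable" "S \<subseteq> {a..b}" "a \<le> b" "e > 0"
  obtains u v :: "nat \<Rightarrow> real"
  where "\<And>n. u n \<le> v n" "\<And>n. {u n..v n} \<subseteq> {a..b}" "S \<subseteq> (\<Union>n. {u n..v n})"
    "(\<Sum>n. ennreal (v n - u n)) \<le> ennreal (measure lebesgue S + e)"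
proof -
  obtain \<D> where cD: "countable \<D>"
    and D: "\<And>K. K \<in> \<D> \<Longrightarrow> K \<subseteq> cbox a b \<and> K \<noteq> {} \<and> (\<exists>c d. K = cbox c d)"
    and disj: "pairwise (\<lambda>A B. interior A \<inter> interior B = {}) \<D>"
    and S: "S \<subseteq> \<Union>\<D>" and meas: "\<Union>\<D> \<in> lmeasurable"
    and le: "measure lebesgue (\<Union>\<D>) \<le> measure lebesgue S + e"
  proof (rule measurable_outer_intervals_bounded)
    show "S \<subseteq> cbox a b" using assms by simp
  qed (use assms in \<open>simp; blast\<close>)+
  \<comment> \<open>Indexing by \<open>to_nat_on\<close> rather than \<open>from_nat_into\<close> avoids repetitions when \<open>\<D>\<close> is finite;
      unused indices are padded with \<open>{a}\<close>.\<close>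
  define K where "K n = (if n \<in> to_nat_on \<D> ` \<D> then from_nat_into \<D> n else {a..a})" for n
  have K_cases: "K n = {a} \<or> (K n \<in> \<D> \<and> to_nat_on \<D> (K n) = n)" for n
    using cD by (auto simp: K_def)
  have K_to_nat: "K (to_nat_on \<D> k) = k" if "k \<in> \<D>" for k
    using that cD by (auto simp: K_def)
  have "\<exists>c d. c \<le> d \<and> K n = {c..d} \<and> {c..d} \<subseteq> {a..b}" for n
  proof (cases "K n = {a}")
    case True
    then show ?thesis using assms by (intro exI[of _ a]) auto
  next
    case False
    then have "K n \<in> \<D>" using K_cases by blast
    then obtain c d where "K n = {c..d}" using D[of "K n"] by auto
    then show ?thesis using D[OF \<open>K n \<in> \<D>\<close>] by (intro exI[of _ c] exI[of _ d]) auto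
  qed
  then obtain u v where uv: "\<And>n. u n \<le> v n" "\<And>n. K n = {u n..v n}" "\<And>n. {u n..v n} \<subseteq> {a..b}"
    by metis
  show ?thesis
  proof
    show "S \<subseteq> (\<Union>n. {u n..v n})"
    proof
      fix x assume "x \<in> S"
      then obtain k where k: "k \<in> \<D>" "x \<in> k" using S by blast
      then have "x \<in> K (to_nat_on \<D> k)" by (simp add: K_to_nat)
      then show "x \<in> (\<Union>n. {u n..v n})" unfolding uv(2) by blast
    qed
    \<comment> \<open>The closed intervals may share endpoints, so lengths are summed over their
      interiors: these have the same measure and are disjoint, the padding having empty
      interior.\<close>
    have int: "interior (K n) = {u n<..<v n}" for n
      using uv by simp
    have sub: "interior (K n) \<subseteq> \<Union>\<D>" for n
    proof (cases "K n = {a}")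
      case False
      then have "K n \<in> \<D>" using K_cases by blast
      then show ?thesis using interior_subset by blast
    qed simp
    have "disjoint_family (\<lambda>n. {u n<..<v n})"
      unfolding disjoint_family_on_def int[symmetric]
    proof (intro ballI impI)
      fix m n :: nat assume "m \<noteq> n"
      show "interior (K m) \<inter> interior (K n) = {}"
      proof (cases "K m = {a} \<or> K n = {a}")
        case True then show ?thesis by auto
      next
        case False
        then have "K m \<in> \<D>" "K n \<in> \<D>" "K m \<noteq> K n"
          using K_cases \<open>m \<noteq> n\<close> by metis+
        then show ?thesis using disj by (auto simp: pairwise_def)
      qed
    qed
    then have "(\<Sum>n. emeasure lebesgue {u n<..<v n}) = emeasure lebesgue (\<Union>n. {u n<..<v n})"
      by (intro suminf_emeasure) auto
    also have "\<dots> \<le> emeasure lebesgue (\<Union>\<D>)"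
      using sub meas int by (intro emeasure_mono) (auto intro: fmeasurableD)
    also have "\<dots> \<le> ennreal (measure lebesgue S + e)"
      using le meas by (simp add: emeasure_eq_measure2 ennreal_leI)
    finally show "(\<Sum>n. ennreal (v n - u n)) \<le> ennreal (measure lebesgue S + e)"
      using uv(1) by simp
  qed (use uv in auto)
qed

section \<open>Lipschitz images and increments\<close>

text \<open>Each interval of a near-optimal cover of \<open>T\<close> is mapped into an interval at
  most \<open>L\<close> times as long. The bound is put on a measurable superset \<open>V\<close>,
  since \<open>emeasure\<close> is informative only on measurable sets.\<close>

lemma lipschitz_image_outer_measure:
  fixes f :: "real \<Rightarrow> real"
  assumes f: "L-lipschitz_on {a..b} f" and T: "T \<in> lmeasurable" "T \<subseteq> {a..b}" and "a \<le> b" "e > 0"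
  obtains V where "V \<in> sets lebesgue" "f ` T \<subseteq> V"
    "emeasure lebesgue V \<le> ennreal (L * measure lebesgue T + e)"
proof -
  have L: "L \<ge> 0" using f lipschitz_on_nonneg by blast
  \<comment> \<open>Dividing by \<open>L + 1\<close> instead of \<open>L\<close> also covers
    \<open>L = 0\<close>.\<close>
  define e' where "e' = e / (L + 1)"
  have e': "e' > 0" "L * e' \<le> e" using L \<open>e > 0\<close> by (auto simp: e'_def field_simps)
  obtain u v :: "nat \<Rightarrow> real" where uv: "\<And>n. u n \<le> v n" "\<And>n. {u n..v n} \<subseteq> {a..b}"
    and cover: "T \<subseteq> (\<Union>n. {u n..v n})"
    and le: "(\<Sum>n. ennreal (v n - u n)) \<le> ennreal (measure lebesgue T + e')"
    using lebesgue_interval_cover[OF T \<open>a \<le> b\<close> e'(1)] by blast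
  \<comment> \<open>Centring at the image of the midpoint gives \<open>I n\<close> length exactly
    \<open>L\<close> times that of the source; centring at the image of an endpoint would double
    it.\<close>
  define c where "c n = f ((u n + v n) / 2)" for n
  define I where "I n = {c n - L * ((v n - u n) / 2)..c n + L * ((v n - u n) / 2)}" for n
  have fI: "f ` {u n..v n} \<subseteq> I n" for n
  proof
    fix y assume "y \<in> f ` {u n..v n}"
    then obtain x where x: "x \<in> {u n..v n}" "y = f x" by auto
    have "(u n + v n) / 2 \<in> {u n..v n}" using uv(1)[of n] by (auto simp: field_simps)
    then have "dist (f x) (c n) \<le> L * dist x ((u n + v n) / 2)"
      unfolding c_def using x uv(2)[of n] by (intro lipschitz_onD[OF f]) auto
    also have "\<dots> \<le> L * ((v n - u n) / 2)"
      using x L by (intro mult_left_mono) (auto simp: dist_real_def abs_le_iff field_simps)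
    finally show "y \<in> I n"
      using x(2) unfolding I_def dist_real_def atLeastAtMost_iff by linarith
  qed
  have "emeasure lebesgue (\<Union>n. I n) \<le> (\<Sum>n. emeasure lebesgue (I n))"
    by (intro emeasure_subadditive_countably) (auto simp: I_def)
  also have "\<dots> = (\<Sum>n. ennreal L * ennreal (v n - u n))"
  proof (intro suminf_cong)
    fix n
    have "0 \<le> L * ((v n - u n) / 2)" using L uv(1)[of n] by auto
    moreover have "emeasure lebesgue {c n - h..c n + h} = ennreal (2 * h)" if "h \<ge> 0" for h
      using that by simp
    ultimately have "emeasure lebesgue (I n) = ennreal (L * (v n - u n))"
      unfolding I_def by fastforce
    then show "emeasure lebesgue (I n) = ennreal L * ennreal (v n - u n)"
      using L uv(1)[of n] by (simp add: ennreal_mult)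
  qed
  also have "\<dots> \<le> ennreal L * ennreal (measure lebesgue T + e')"
    using le by (simp add: mult_left_mono)
  also have "\<dots> \<le> ennreal (L * measure lebesgue T + e)"
    using L e' by (simp add: distrib_left ennreal_leI flip: ennreal_mult ennreal_plus)
  finally have "emeasure lebesgue (\<Union>n. I n) \<le> ennreal (L * measure lebesgue T + e)" .
  moreover have "f ` T \<subseteq> (\<Union>n. I n)"
  proof -
    have "f ` T \<subseteq> (\<Union>n. f ` {u n..v n})" 
      unfolding image_UN[symmetric] using cover by (rule image_mono)
    also have "\<dots> \<subseteq> (\<Union>n. I n)" using fI by (rule UN_mono[OF subset_refl])
    finally show ?thesis .
  qed
  ultimately show ?thesis
    using that[of "\<Union>n. I n"] by (auto simp: I_def)
qed

text \<open>By the intermediate value theorem the image of \<open>{a..b}\<close> contains the whole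
  interval between \<open>f a\<close> and \<open>f b\<close>. The part of the image coming from
  \<open>S\<close> is null, so the rest, coming from \<open>{a..b} - S\<close>, must account for the
  full length.\<close>

lemma lipschitz_increment_le_measure_Diff:
  fixes f :: "real \<Rightarrow> real"
  assumes f: "L-lipschitz_on {a..b} f" and "a \<le> b" and S: "S \<in> sets lebesgue"
    and null: "negligible (f ` ({a..b} \<inter> S))"
  shows "\<bar>f b - f a\<bar> \<le> L * measure lebesgue ({a..b} - S)"
proof (rule field_le_epsilon)
  fix e :: real assume "e > 0"
  have L: "L \<ge> 0" using f lipschitz_on_nonneg by blast
  have T: "{a..b} - S \<in> lmeasurable"
    using S by (intro fmeasurable_Diff) auto
  obtain V where V: "V \<in> sets lebesgue" "f ` ({a..b} - S) \<subseteq> V"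
    "emeasure lebesgue V \<le> ennreal (L * measure lebesgue ({a..b} - S) + e)"
    using lipschitz_image_outer_measure[OF f T _ \<open>a \<le> b\<close> \<open>e > 0\<close>] by blast
  have "{min (f a) (f b)..max (f a) (f b)} \<subseteq> f ` {a..b}"
  proof
    fix y assume y: "y \<in> {min (f a) (f b)..max (f a) (f b)}"
    have cont: "continuous_on {a..b} f" using f by (rule lipschitz_on_continuous_on)
    show "y \<in> f ` {a..b}"
    proof (cases "f a \<le> f b")
      case True
      then show ?thesis using IVT'[of f a y b] y cont \<open>a \<le> b\<close> by force
    next
      case False
      then show ?thesis using IVT2'[of f b y a] y cont \<open>a \<le> b\<close> by force
    qed
  qed
  also have "f ` {a..b} \<subseteq> f ` ({a..b} \<inter> S) \<union> V" using V by auto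
  finally have sub: "{min (f a) (f b)..max (f a) (f b)} \<subseteq> f ` ({a..b} \<inter> S) \<union> V" .
  have nullset: "f ` ({a..b} \<inter> S) \<in> null_sets lebesgue"
    using null negligible_iff_null_sets by blast
  have "ennreal \<bar>f b - f a\<bar> = emeasure lebesgue {min (f a) (f b)..max (f a) (f b)}"
    by (auto simp: min_def max_def)
  also have "\<dots> \<le> emeasure lebesgue (f ` ({a..b} \<inter> S) \<union> V)"
    using sub V nullset by (intro emeasure_mono) auto
  also have "\<dots> = emeasure lebesgue V"
    using emeasure_Un_null_set[OF V(1) nullset] by (simp add: Un_commute)
  also have "\<dots> \<le> ennreal (L * measure lebesgue ({a..b} - S) + e)" by fact
  finally show "\<bar>f b - f a\<bar> \<le> L * measure lebesgue ({a..b} - S) + e"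
    using L \<open>e > 0\<close> by (subst (asm) ennreal_le_iff) (auto intro!: add_nonneg_nonneg)
qed

section \<open>Null sets from a uniform density bound\<close>

text \<open>An elementary stand-in for the Lebesgue density theorem: summing the density bound over
  a cover of total length at most \<open>m + e\<close>, where \<open>m\<close> is the measure of
  \<open>S\<close>, gives \<open>m \<le> q * (m + e)\<close>, hence \<open>m \<le> q * m\<close> and
  \<open>m = 0\<close>.\<close>

lemma negligible_if_density_le:
  fixes S :: "real set"
  assumes S: "S \<in> sets lebesgue" "S \<subseteq> {a..b}" and q: "0 \<le> q" "q < 1"
    and density: "\<And>x y. \<lbrakk>a \<le> x; x \<le> y; y \<le> b\<rbrakk> \<Longrightarrow> measure lebesgue ({x..y} \<inter> S) \<le> q * (y - x)"
  shows "negligible S"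
proof (cases "a \<le> b")
  case True
  have Sm: "S \<in> lmeasurable"
    using S bounded_subset[of "{a..b}" S] by (intro bounded_set_imp_lmeasurable) auto
  define m where "m = measure lebesgue S"
  have "m \<le> q * m + e" if "e > 0" for e
  proof -
    obtain u v :: "nat \<Rightarrow> real" where uv: "\<And>n. u n \<le> v n" "\<And>n. {u n..v n} \<subseteq> {a..b}"
      and cover: "S \<subseteq> (\<Union>n. {u n..v n})"
      and le: "(\<Sum>n. ennreal (v n - u n)) \<le> ennreal (m + e)"
      using lebesgue_interval_cover[OF Sm S(2) True \<open>e > 0\<close>] unfolding m_def by blast
    have "ennreal m = emeasure lebesgue S"
      using Sm by (simp add: m_def emeasure_eq_measure2)
    also have "S = (\<Union>n. {u n..v n} \<inter> S)" using cover by auto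
    also have "emeasure lebesgue \<dots> \<le> (\<Sum>n. emeasure lebesgue ({u n..v n} \<inter> S))"
      using S by (intro emeasure_subadditive_countably) auto
    also have "\<dots> \<le> (\<Sum>n. ennreal q * ennreal (v n - u n))"
    proof (intro suminf_le)
      fix n
      have "emeasure lebesgue ({u n..v n} \<inter> S) = ennreal (measure lebesgue ({u n..v n} \<inter> S))"
        using Sm by (intro emeasure_eq_measure2) auto
      also have "\<dots> \<le> ennreal (q * (v n - u n))"
        using uv(1)[of n] uv(2)[of n] by (intro ennreal_leI density) auto
      finally show "emeasure lebesgue ({u n..v n} \<inter> S) \<le> ennreal q * ennreal (v n - u n)"
        using q uv(1)[of n] by (simp add: ennreal_mult)
    qed auto
    also have "\<dots> \<le> ennreal q * ennreal (m + e)"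
      using le by (simp add: mult_left_mono)
    also have "\<dots> = ennreal (q * (m + e))"
      using q \<open>e > 0\<close> by (simp add: ennreal_mult m_def)
    finally have "m \<le> q * (m + e)"
      using q \<open>e > 0\<close> by (subst (asm) ennreal_le_iff) (auto simp: m_def)
    also have "\<dots> \<le> q * m + e"
      using q \<open>e > 0\<close> by (simp add: distrib_left mult_left_le_one_le)
    finally show ?thesis .
  qed
  then have "m \<le> q * m" by (rule field_le_epsilon)
  then have "(1 - q) * m \<le> 0" by (simp add: algebra_simps)
  then have "m \<le> 0" using q by (simp add: mult_le_0_iff)
  then have "m = 0" by (simp add: m_def order_antisym)
  then show ?thesis using Sm by (simp add: m_def negligible_iff_measure)
next
  case False
  then show ?thesis using S by auto
qed

text \<open>Both increments over an interval are at most \<open>L\<close> times the measure of the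
  complement of \<open>S\<close> in it, while \<open>expand\<close> bounds the length by these
  increments. So the complement fills at least the fraction \<open>1 / K\<close> of every
  interval.\<close>

lemma negligible_if_two_null_images:
  fixes f g :: "real \<Rightarrow> real"
  assumes f: "L-lipschitz_on {a..b} f" and g: "L-lipschitz_on {a..b} g"
    and expand: "\<And>x y. \<lbrakk>a \<le> x; x \<le> y; y \<le> b\<rbrakk> \<Longrightarrow> y - x \<le> C * (\<bar>f y - f x\<bar> + \<bar>g y - g x\<bar>)"
    and "C \<ge> 0"
    and S: "S \<in> sets lebesgue" "S \<subseteq> {a..b}"
    and null: "negligible (f ` S)" "negligible (g ` S)"
  shows "negligible S"
proof -
  have L: "L \<ge> 0" using f lipschitz_on_nonneg by blast
  \<comment> \<open>The factor 2 counts the two functions; adding 1 ensures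
    \<open>K \<ge> 1\<close>, which puts the density bound \<open>1 - 1 / K\<close> in the required
    range.\<close>
  define K where "K = 2 * C * L + 1"
  have K: "K \<ge> 1" using L \<open>C \<ge> 0\<close> by (simp add: K_def)
  show ?thesis
  proof (rule negligible_if_density_le[OF S])
    show "0 \<le> 1 - 1 / K" "1 - 1 / K < 1" using K by auto
  next
    fix x y assume xy: "a \<le> x" "x \<le> y" "y \<le> b"
    define \<mu> where "\<mu> = measure lebesgue ({x..y} - S)"
    have incr: "\<bar>h y - h x\<bar> \<le> L * \<mu>" if "L-lipschitz_on {a..b} h" "negligible (h ` S)" for h
      unfolding \<mu>_def
    proof (rule lipschitz_increment_le_measure_Diff)
      show "L-lipschitz_on {x..y} h"
        using xy by (intro lipschitz_on_subset[OF that(1)]) auto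
      show "negligible (h ` ({x..y} \<inter> S))"
        by (rule negligible_subset[OF that(2)]) auto
    qed (use xy S in auto)
    have "y - x \<le> C * (\<bar>f y - f x\<bar> + \<bar>g y - g x\<bar>)"
      by (rule expand[OF xy])
    also have "\<dots> \<le> C * (L * \<mu> + L * \<mu>)"
      using \<open>C \<ge> 0\<close> by (intro mult_left_mono add_mono incr f g null)
    also have "\<dots> \<le> K * \<mu>"
      by (simp add: K_def \<mu>_def algebra_simps)
    finally have "(y - x) / K \<le> \<mu>"
      using K by (simp add: divide_le_eq mult.commute)
    moreover have "measure lebesgue ({x..y} \<inter> S) = (y - x) - \<mu>"
    proof -
      have "{x..y} - S = {x..y} - {x..y} \<inter> S" by auto
      also have "measure lebesgue \<dots> = measure lebesgue {x..y} - measure lebesgue ({x..y} \<inter> S)"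
        using S by (intro measurable_measure_Diff) auto
      finally show ?thesis using xy by (simp add: \<mu>_def)
    qed
    ultimately show "measure lebesgue ({x..y} \<inter> S) \<le> (1 - 1 / K) * (y - x)"
      by (simp add: algebra_simps)
  qed
qed

section \<open>Local linearisation of the two curve projections\<close>

text \<open>This is strict differentiability at \<open>s\<close>: both \<open>u\<close> and
  \<open>v\<close> vary. Subtracting the linear function of slope \<open>deriv \<gamma> s\<close>
  leaves a derivative of size at most \<open>e\<close> near \<open>s\<close>, by continuity, and the
  mean value bound applies.\<close>

lemma C1_increment_approx:
  fixes \<gamma> :: "real \<Rightarrow> real"
  assumes "\<gamma> C1_differentiable_on UNIV" "e > 0"
  obtains d where "d > 0"
    "\<And>u v. \<lbrakk>\<bar>u - s\<bar> < d; \<bar>v - s\<bar> < d\<rbrakk> \<Longrightarrow> \<bar>\<gamma> u - \<gamma> v - deriv \<gamma> s * (u - v)\<bar> \<le> e * \<bar>u - v\<bar>"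
proof -
  obtain D where D: "\<And>x. (\<gamma> has_vector_derivative D x) (at x)" and cont: "continuous_on UNIV D"
    using assms(1) unfolding C1_differentiable_on_def by auto
  have D': "(\<gamma> has_field_derivative D x) (at x)" for x
    using D by (simp add: has_real_derivative_iff_has_vector_derivative)
  have "deriv \<gamma> s = D s" using D' by (rule DERIV_imp_deriv)
  obtain d where d: "d > 0" "\<And>x. \<bar>x - s\<bar> < d \<Longrightarrow> \<bar>D x - D s\<bar> < e"
    using cont \<open>e > 0\<close> unfolding continuous_on_iff dist_real_def by (metis UNIV_I)
  show ?thesis
  proof (rule that[OF d(1)])
    fix u v assume uv: "\<bar>u - s\<bar> < d" "\<bar>v - s\<bar> < d"
    define h where "h x = \<gamma> x - D s * x" for x
    have "norm (h u - h v) \<le> e * norm (u - v)"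
    proof (rule field_differentiable_bound)
      show "convex (ball s d)" by simp
      fix x assume "x \<in> ball s d"
      then show "norm (D x - D s) \<le> e"
        using d(2)[of x] by (auto simp: dist_real_def abs_minus_commute)
      show "(h has_field_derivative D x - D s) (at x within ball s d)"
        unfolding h_def by (auto intro!: derivative_eq_intros DERIV_subset[OF D'])
    qed (use uv in \<open>auto simp: dist_real_def abs_minus_commute\<close>)
    then show "\<bar>\<gamma> u - \<gamma> v - deriv \<gamma> s * (u - v)\<bar> \<le> e * \<bar>u - v\<bar>"
      by (simp add: h_def \<open>deriv \<gamma> s = D s\<close> algebra_simps)
  qed
qed

text \<open>\<open>P\<close> and \<open>Q\<close> stand for the coordinates of the parametrised
  graph. Near \<open>x0\<close> the increments of the two projections are close to those of
  \<open>Q - deriv \<gamma> s * P\<close> and \<open>Q - deriv \<gamma> t * P\<close>; injectivity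
  of \<open>deriv \<gamma>\<close> makes this linear system invertible, and negligibility is a local
  property.\<close>

lemma negligible_parameters_if_two_null_projections:
  fixes P Q \<gamma> :: "real \<Rightarrow> real"
  assumes P: "\<And>x y. \<bar>P x - P y\<bar> \<le> M * \<bar>x - y\<bar>" and Q: "\<And>x y. \<bar>Q x - Q y\<bar> \<le> M * \<bar>x - y\<bar>"
    and PQ: "\<And>x y. \<bar>x - y\<bar> \<le> \<bar>P x - P y\<bar> + \<bar>Q x - Q y\<bar>"
    and \<gamma>: "\<gamma> C1_differentiable_on UNIV" and inj: "inj (deriv \<gamma>)" and "\<alpha> \<noteq> \<beta>"
    and S: "S \<in> sets lebesgue"
    and null: "negligible ((\<lambda>x. Q x + \<gamma> (\<alpha> - P x)) ` S)" "negligible ((\<lambda>x. Q x + \<gamma> (\<beta> - P x)) ` S)"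
  shows "negligible S"
proof (subst locally_negligible_alt, intro ballI)
  fix x0 assume "x0 \<in> S"
  define s t where "s = \<alpha> - P x0" and "t = \<beta> - P x0"
  \<comment> \<open>Up to sign, the determinant of the linearised system.\<close>
  define m where "m = \<bar>deriv \<gamma> s - deriv \<gamma> t\<bar>"
  have "m > 0" using \<open>\<alpha> \<noteq> \<beta>\<close> inj by (auto simp: m_def s_def t_def inj_eq)
  have "M \<ge> 0" using P[of 0 1] by auto
  \<comment> \<open>With tolerance \<open>m / 4\<close> in each linearisation the two errors add up
    to \<open>m / 2\<close>, so half of the determinant survives in the bound
    \<open>Pw\<close>.\<close>
  obtain d1 where d1: "d1 > 0" "\<And>u v. \<lbrakk>\<bar>u - s\<bar> < d1; \<bar>v - s\<bar> < d1\<rbrakk> \<Longrightarrow>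
      \<bar>\<gamma> u - \<gamma> v - deriv \<gamma> s * (u - v)\<bar> \<le> m / 4 * \<bar>u - v\<bar>"
    using C1_increment_approx[OF \<gamma>, of "m / 4" s] \<open>m > 0\<close> by auto
  obtain d2 where d2: "d2 > 0" "\<And>u v. \<lbrakk>\<bar>u - t\<bar> < d2; \<bar>v - t\<bar> < d2\<rbrakk> \<Longrightarrow>
      \<bar>\<gamma> u - \<gamma> v - deriv \<gamma> t * (u - v)\<bar> \<le> m / 4 * \<bar>u - v\<bar>"
    using C1_increment_approx[OF \<gamma>, of "m / 4" t] \<open>m > 0\<close> by auto
  \<comment> \<open>On this radius \<open>P\<close> moves by at most \<open>M * r\<close>, strictly
    less than \<open>min d1 d2\<close>, also when \<open>M = 0\<close>.\<close>
  define r where "r = min d1 d2 / (M + 1)"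
  have "r > 0" using d1 d2 \<open>M \<ge> 0\<close> by (simp add: r_def)
  have near: "\<bar>P x - P x0\<bar> < min d1 d2" if "x \<in> {x0 - r..x0 + r}" for x
  proof -
    have "\<bar>P x - P x0\<bar> \<le> M * \<bar>x - x0\<bar>" by (rule P)
    also have "\<dots> \<le> M * r" using that \<open>M \<ge> 0\<close> by (intro mult_left_mono) auto
    also have "\<dots> < (M + 1) * r" using \<open>r > 0\<close> by (simp add: algebra_simps)
    also have "\<dots> = min d1 d2" using \<open>M \<ge> 0\<close> by (simp add: r_def)
    finally show ?thesis .
  qed
  define f where "f x = Q x + \<gamma> (\<alpha> - P x)" for x
  define g where "g x = Q x + \<gamma> (\<beta> - P x)" for x
  \<comment> \<open>The slope term has a plus sign because \<open>P\<close> enters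
    \<open>\<gamma>\<close> with a minus sign.\<close>
  have f: "\<bar>(f x - f y) - (Q x - Q y) + deriv \<gamma> s * (P x - P y)\<bar> \<le> m / 4 * \<bar>P x - P y\<bar>"
    if "x \<in> {x0 - r..x0 + r}" "y \<in> {x0 - r..x0 + r}" for x y
    using d1(2)[of "\<alpha> - P x" "\<alpha> - P y"] near[OF that(1)] near[OF that(2)]
    by (simp add: f_def s_def abs_minus_commute algebra_simps)
  have g: "\<bar>(g x - g y) - (Q x - Q y) + deriv \<gamma> t * (P x - P y)\<bar> \<le> m / 4 * \<bar>P x - P y\<bar>"
    if "x \<in> {x0 - r..x0 + r}" "y \<in> {x0 - r..x0 + r}" for x y
    using d2(2)[of "\<beta> - P x" "\<beta> - P y"] near[OF that(1)] near[OF that(2)]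
    by (simp add: g_def t_def abs_minus_commute algebra_simps)
  define B where "B = \<bar>deriv \<gamma> s\<bar> + \<bar>deriv \<gamma> t\<bar> + m / 4"
  have "B \<ge> 0" using \<open>m > 0\<close> by (simp add: B_def)
  define L where "L = M + B * M"
  \<comment> \<open>Stated for a general slope \<open>c\<close> to serve both \<open>f\<close>, with
    \<open>deriv \<gamma> s\<close>, and \<open>g\<close>, with
    \<open>deriv \<gamma> t\<close>.\<close>
  have lip: "L-lipschitz_on {x0 - r..x0 + r} h"
    if h: "\<And>x y. \<lbrakk>x \<in> {x0 - r..x0 + r}; y \<in> {x0 - r..x0 + r}\<rbrakk> \<Longrightarrow>
       \<bar>(h x - h y) - (Q x - Q y) + c * (P x - P y)\<bar> \<le> m / 4 * \<bar>P x - P y\<bar>"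
     and c: "\<bar>c\<bar> + m / 4 \<le> B" for h c
  proof (rule lipschitz_onI)
    fix x y assume "x \<in> {x0 - r..x0 + r}" "y \<in> {x0 - r..x0 + r}"
    then have "\<bar>h x - h y\<bar> \<le> \<bar>Q x - Q y\<bar> + \<bar>c * (P x - P y)\<bar> + m / 4 * \<bar>P x - P y\<bar>"
      using h[of x y] by linarith
    also have "\<dots> = \<bar>Q x - Q y\<bar> + (\<bar>c\<bar> + m / 4) * \<bar>P x - P y\<bar>"
      by (simp add: abs_mult distrib_right)
    also have "\<dots> \<le> M * \<bar>x - y\<bar> + B * (M * \<bar>x - y\<bar>)"
      using c \<open>B \<ge> 0\<close> by (intro add_mono mult_mono P Q) auto
    finally show "dist (h x) (h y) \<le> L * dist x y"
      by (simp add: L_def dist_real_def algebra_simps)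
  qed (use \<open>M \<ge> 0\<close> \<open>B \<ge> 0\<close> in \<open>simp add: L_def\<close>)
  \<comment> \<open>Read off from the final estimate \<open>w + (1 + B) * (2 / m * w)\<close> in
    \<open>expand\<close>.\<close>
  define C where "C = 1 + (1 + B) * (2 / m)"
  have "C \<ge> 0" using \<open>B \<ge> 0\<close> \<open>m > 0\<close> by (simp add: C_def)
  have expand: "y - x \<le> C * (\<bar>f y - f x\<bar> + \<bar>g y - g x\<bar>)"
    if xy: "x0 - r \<le> x" "x \<le> y" "y \<le> x0 + r" for x y
  proof -
    define w where "w = \<bar>f y - f x\<bar> + \<bar>g y - g x\<bar>"
    have fyx: "\<bar>(f y - f x) - (Q y - Q x) + deriv \<gamma> s * (P y - P x)\<bar> \<le> m / 4 * \<bar>P y - P x\<bar>"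
      using xy by (intro f) auto
    have gyx: "\<bar>(g y - g x) - (Q y - Q x) + deriv \<gamma> t * (P y - P x)\<bar> \<le> m / 4 * \<bar>P y - P x\<bar>"
      using xy by (intro g) auto
    \<comment> \<open>Subtracting the linearisations of \<open>f\<close> and \<open>g\<close> eliminates \<open>Q\<close>.\<close>
    have "m * \<bar>P y - P x\<bar> = \<bar>deriv \<gamma> s * (P y - P x) - deriv \<gamma> t * (P y - P x)\<bar>"
      by (simp add: m_def abs_mult left_diff_distrib flip: abs_mult)
    also have "\<dots> \<le> m / 2 * \<bar>P y - P x\<bar> + w"
      using fyx gyx unfolding w_def by linarith
    finally have Pw: "\<bar>P y - P x\<bar> \<le> 2 / m * w"
      using \<open>m > 0\<close> by (simp add: field_simps)
    have "\<bar>Q y - Q x\<bar> \<le> \<bar>f y - f x\<bar> + \<bar>deriv \<gamma> s * (P y - P x)\<bar> + m / 4 * \<bar>P y - P x\<bar>"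
      using fyx by linarith
    also have "\<dots> = \<bar>f y - f x\<bar> + (\<bar>deriv \<gamma> s\<bar> + m / 4) * \<bar>P y - P x\<bar>"
      by (simp add: abs_mult distrib_right)
    also have "\<dots> \<le> w + B * \<bar>P y - P x\<bar>"
      by (intro add_mono mult_right_mono) (auto simp: w_def B_def)
    finally have "\<bar>P y - P x\<bar> + \<bar>Q y - Q x\<bar> \<le> w + (1 + B) * \<bar>P y - P x\<bar>"
      by (simp add: algebra_simps)
    also have "\<dots> \<le> w + (1 + B) * (2 / m * w)"
      using Pw \<open>B \<ge> 0\<close> by (intro add_left_mono mult_left_mono) auto
    finally show ?thesis
      using PQ[of y x] xy by (simp add: C_def w_def[symmetric] algebra_simps)
  qed
  have "negligible (S \<inter> {x0 - r..x0 + r})"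
  proof (rule negligible_if_two_null_images[where f = f and g = g])
    show "L-lipschitz_on {x0 - r..x0 + r} f" "L-lipschitz_on {x0 - r..x0 + r} g"
      by (rule lip[OF f] lip[OF g]; simp add: B_def)+
    show "negligible (f ` (S \<inter> {x0 - r..x0 + r}))"
      using null(1) by (rule negligible_subset) (auto simp: f_def)
    show "negligible (g ` (S \<inter> {x0 - r..x0 + r}))"
      using null(2) by (rule negligible_subset) (auto simp: g_def)
  qed (use expand \<open>C \<ge> 0\<close> S in auto)
  then have "negligible (S \<inter> {x0 - r<..<x0 + r})"
    by (rule negligible_subset) auto
  then show "\<exists>U. openin (top_of_set S) U \<and> x0 \<in> U \<and> negligible U"
    using \<open>x0 \<in> S\<close> \<open>r > 0\<close> by (intro exI[of _ "S \<inter> {x0 - r<..<x0 + r}"]) (auto intro: openin_open_Int)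
qed

section \<open>Hausdorff measure of Lipschitz images\<close>

text \<open>Images of the intervals of a cover of \<open>A\<close> with small total length form an
  admissible cover whose diameters are at most \<open>M\<close> times the lengths.\<close>

lemma hausdorff1_lipschitz_image_negligible:
  fixes p :: "real \<Rightarrow> 'a::metric_space"
  assumes p: "M-lipschitz_on UNIV p" and A: "negligible A" "bounded A"
  shows "hausdorff1 (p ` A) = 0"
proof -
  have M: "M \<ge> 0" using p lipschitz_on_nonneg by blast
  obtain c where "c > 0" "\<And>x. x \<in> A \<Longrightarrow> norm x \<le> c"
    using A(2) bounded_pos by metis
  then have c: "A \<subseteq> {-c..c}" "c \<ge> 0"
    by (force simp: abs_le_iff)+
  have "hausdorff1_approx \<delta> (p ` A) \<le> 0" if "\<delta> > 0" for \<delta>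
  proof (rule ennreal_le_epsilon)
    fix \<epsilon> :: real assume "\<epsilon> > 0"
    \<comment> \<open>One choice controls both the sum of the diameters, through
      \<open>\<epsilon>\<close>, and each single diameter, through \<open>\<delta>\<close>.\<close>
    define e where "e = min \<epsilon> \<delta> / (M + 1)"
    have "e > 0" using \<open>\<epsilon> > 0\<close> \<open>\<delta> > 0\<close> M by (simp add: e_def)
    have "(M + 1) * e = min \<epsilon> \<delta>" using M by (simp add: e_def)
    then have Me: "M * e \<le> \<epsilon>" "M * e \<le> \<delta>" using \<open>e > 0\<close> by (auto simp: algebra_simps)
    have Am: "A \<in> lmeasurable" "measure lebesgue A = 0"
      using A(1) by (auto simp: negligible_iff_measure)
    obtain u v :: "nat \<Rightarrow> real" where uv: "\<And>n. u n \<le> v n" and cover: "A \<subseteq> (\<Union>n. {u n..v n})"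
      and le: "(\<Sum>n. ennreal (v n - u n)) \<le> ennreal e"
      using lebesgue_interval_cover[OF Am(1) c(1) _ \<open>e > 0\<close>, unfolded Am(2) add_0]
        \<open>c \<ge> 0\<close> by (smt (verit))
    define U where "U n = p ` {u n..v n}" for n
    have bU: "bounded (U n)" for n
      unfolding U_def by (intro compact_imp_bounded compact_continuous_image
        continuous_on_subset[OF lipschitz_on_continuous_on[OF p]]) auto
    have dU: "diameter (U n) \<le> M * (v n - u n)" for n
    proof -
      have "dist (p x) (p y) \<le> M * (v n - u n)" if "x \<in> {u n..v n}" "y \<in> {u n..v n}" for x y
      proof -
        have "dist (p x) (p y) \<le> M * dist x y" by (rule lipschitz_onD[OF p]) auto
        also have "\<dots> \<le> M * (v n - u n)"
          using that M by (intro mult_left_mono) (auto simp: dist_real_def)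
        finally show ?thesis .
      qed
      moreover have "U n \<noteq> {}" using uv[of n] by (simp add: U_def)
      ultimately show ?thesis
        unfolding diameter_def by (auto simp: U_def intro!: cSUP_least)
    qed
    \<comment> \<open>No mesh bound comes with the cover; each length is bounded by the whole
      sum.\<close>
    have "ennreal (v n - u n) \<le> ennreal e" for n
      using le sum_le_suminf[of "\<lambda>n. ennreal (v n - u n)" "{n}"] by (auto intro: order_trans)
    then have "v n - u n \<le> e" for n using \<open>e > 0\<close> by (simp add: ennreal_le_iff)
    then have "diameter (U n) \<le> \<delta>" for n
      using dU[of n] Me(2) M by (meson mult_left_mono order_trans)
    moreover have "p ` A \<subseteq> (\<Union>n. U n)"
      unfolding U_def image_UN[symmetric] using cover by (rule image_mono)
    ultimately have "hausdorff1_approx \<delta> (p ` A) \<le> (\<Sum>n. ennreal (diameter (U n)))"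
      unfolding hausdorff1_approx_def using bU by (intro INF_lower) simp
    also have "\<dots> \<le> (\<Sum>n. ennreal M * ennreal (v n - u n))"
      using M uv dU by (intro suminf_le) (auto simp: ennreal_leI simp flip: ennreal_mult)
    also have "\<dots> \<le> ennreal M * ennreal e"
      using le by (simp add: mult_left_mono)
    also have "\<dots> \<le> ennreal \<epsilon>"
      using M Me \<open>e > 0\<close> by (simp add: ennreal_leI flip: ennreal_mult)
    finally show "hausdorff1_approx \<delta> (p ` A) \<le> 0 + ennreal \<epsilon>" by simp
  qed
  then show ?thesis
    unfolding hausdorff1_def by (auto simp: SUP_eq_iff intro!: antisym SUP_least)
qed

section \<open>Application to Lipschitz graphs\<close>

theorem corollary2p5:
  fixes E :: "(real ^ 2) set" and \<gamma> :: "real \<Rightarrow> real"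
  assumes "compact E"
    and "\<gamma> C1_differentiable_on UNIV"
    and "inj (deriv \<gamma>)"
    and "\<exists>\<alpha> \<alpha>'. \<alpha> \<noteq> \<alpha>' \<and>
           emeasure lebesgue (curve_projection \<gamma> \<alpha> ` E) = 0 \<and>
           emeasure lebesgue (curve_projection \<gamma> \<alpha>' ` E) = 0"
  shows "purely_1_unrectifiable E"
  unfolding purely_1_unrectifiable_def
proof (intro allI impI)
  fix \<zeta> assume "lipschitz_graph \<zeta>"
  then obtain F :: "real \<Rightarrow> real" and L \<omega>1 \<omega>2 where F: "L-lipschitz_on UNIV F"
    and \<omega>: "norm \<omega>1 = 1" "norm \<omega>2 = 1" "\<omega>1 \<bullet> \<omega>2 = 0"
    and \<zeta>: "\<zeta> = {x *\<^sub>R \<omega>1 + F x *\<^sub>R \<omega>2 | x. x \<in> UNIV}"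
    unfolding lipschitz_graph_def by blast
  obtain \<alpha> \<beta> where "\<alpha> \<noteq> \<beta>"
    and null: "emeasure lebesgue (curve_projection \<gamma> \<alpha> ` E) = 0"
      "emeasure lebesgue (curve_projection \<gamma> \<beta> ` E) = 0"
    using assms(4) by blast
  define p where "p x = x *\<^sub>R \<omega>1 + F x *\<^sub>R \<omega>2" for x
  define S where "S = p -` E"
  have p_lip: "(1 + L)-lipschitz_on UNIV p"
  proof (rule lipschitz_onI)
    fix x y
    have "dist (p x) (p y) = norm ((x - y) *\<^sub>R \<omega>1 + (F x - F y) *\<^sub>R \<omega>2)"
      by (simp add: p_def dist_norm algebra_simps)
    also have "\<dots> \<le> \<bar>x - y\<bar> + \<bar>F x - F y\<bar>"
      by (rule norm_triangle_le) (simp add: \<omega>)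
    also have "\<dots> \<le> (1 + L) * dist x y"
      using lipschitz_onD[OF F, of x y] by (simp add: dist_real_def algebra_simps)
    finally show "dist (p x) (p y) \<le> (1 + L) * dist x y" .
  qed (use lipschitz_on_nonneg[OF F] in simp)
  \<comment> \<open>Pairing with \<open>\<omega>1\<close> recovers the parameter. Hence
    \<open>p\<close> does not shrink distances, and \<open>S\<close> is bounded because
    \<open>E\<close> is.\<close>
  have p_inner: "p x \<bullet> \<omega>1 = x" for x
    using \<omega> by (simp add: p_def inner_add_left inner_commute[of \<omega>2] dot_square_norm)
  have p_expand: "\<bar>x - y\<bar> \<le> norm (p x - p y)" for x y
    using Cauchy_Schwarz_ineq2[of "p x - p y" \<omega>1] \<omega> by (simp add: inner_diff_left p_inner)
  \<comment> \<open>\<open>emeasure\<close> is 0 by default on nonmeasurable sets, so the assumption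
    yields a null set only once measurability is known; it follows from compactness of
    \<open>E\<close>.\<close>
  have emeas: "curve_projection \<gamma> a ` E \<in> sets lebesgue" for a
  proof -
    have "continuous_on UNIV \<gamma>"
      using C1_differentiable_imp_continuous_on assms(2) by blast
    then have "continuous_on E (\<lambda>z. \<gamma> (a - z $ 1))"
      by (rule continuous_on_compose2) (auto intro!: continuous_intros)
    then have "continuous_on E (curve_projection \<gamma> a)"
      unfolding curve_projection_def[abs_def] by (intro continuous_intros)
    then have "compact (curve_projection \<gamma> a ` E)"
      using assms(1) by (rule compact_continuous_image)
    then show ?thesis by (auto intro: fmeasurableD lmeasurable_compact)
  qed
  have "continuous_on UNIV p" using p_lip by (rule lipschitz_on_continuous_on)
  then have "closed S"
    unfolding S_def using assms(1) by (intro closed_vimage) (auto simp: compact_imp_closed)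
  have "bounded S"
  proof -
    obtain c where c: "\<And>z. z \<in> E \<Longrightarrow> norm z \<le> c"
      using compact_imp_bounded[OF assms(1)] unfolding bounded_iff by blast
    have "norm x \<le> c" if "x \<in> S" for x
      using c[of "p x"] that Cauchy_Schwarz_ineq2[of "p x" \<omega>1] \<omega> by (simp add: p_inner S_def)
    then show ?thesis unfolding bounded_iff by blast
  qed
  have "negligible S"
  proof (rule negligible_parameters_if_two_null_projections
      [where P = "\<lambda>x. p x $ 1" and Q = "\<lambda>x. p x $ 2" and M = "1 + L"])
    fix x y
    have comp: "\<bar>p x $ i - p y $ i\<bar> \<le> (1 + L) * \<bar>x - y\<bar>" for i
      using component_le_norm_cart[of "p x - p y" i] lipschitz_onD[OF p_lip, of x y]
      by (simp add: dist_norm)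
    show "\<bar>p x $ 1 - p y $ 1\<bar> \<le> (1 + L) * \<bar>x - y\<bar>" "\<bar>p x $ 2 - p y $ 2\<bar> \<le> (1 + L) * \<bar>x - y\<bar>"
      by (rule comp)+
    show "\<bar>x - y\<bar> \<le> \<bar>p x $ 1 - p y $ 1\<bar> + \<bar>p x $ 2 - p y $ 2\<bar>"
      using p_expand[of x y] norm_le_l1_cart[of "p x - p y"] by (simp add: sum_2)
  next
    have img: "negligible ((\<lambda>x. p x $ 2 + \<gamma> (a - p x $ 1)) ` S)"
      if "emeasure lebesgue (curve_projection \<gamma> a ` E) = 0" for a
    proof (rule negligible_subset)
      show "negligible (curve_projection \<gamma> a ` E)"
        using emeas that by (auto simp: negligible_iff_null_sets)
    qed (auto simp: S_def curve_projection_def)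
    show "negligible ((\<lambda>x. p x $ 2 + \<gamma> (\<alpha> - p x $ 1)) ` S)"
      "negligible ((\<lambda>x. p x $ 2 + \<gamma> (\<beta> - p x $ 1)) ` S)"
      using img null by blast+
  qed (use assms \<open>\<alpha> \<noteq> \<beta>\<close> \<open>closed S\<close> in \<open>auto intro: borel_closed\<close>)
  moreover have "E \<inter> \<zeta> = p ` S" by (auto simp: \<zeta> p_def S_def)
  ultimately show "hausdorff1 (E \<inter> \<zeta>) = 0"
    using hausdorff1_lipschitz_image_negligible[OF p_lip] \<open>bounded S\<close> by simp
qed

end
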